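(* Consider the decentralized control setting of the context: a plant generator $G$ with $L=L(G)$, locally observable alphabets $\Sigma_{o,i}$ and locally controllable alphabets $\Sigma_{c,i}$, $i=1,\dots,n$, satisfying $\Sigma_{o,i}\cap\Sigma_{c,j}\subseteq\Sigma_{c,i}$ for all $i,j$; put $A_i=\Sigma_{o,i}$, $A_{c,i}=\Sigma_{o,i}\cap\Sigma_{c,i}$, with groups $I_1,\dots,I_m$ and alphabets $A_k,A_{k_1},\dots,A_{k_m}$. Let $K\subseteq L$ be languages such that $K$ is two-level conditionally decomposable with respect to $(A_i)_{i=1}^n$, $(A_{k_j})_{j=1}^m$, and $A_k$. For $j=1,\dots,m$ and $i\in I_j$ let $$L_{k_j}=\|_{i=1}^nP_{k_j}(P_i(L)),\quad \sup\mathrm{C}_{k_j}=\sup\mathrm{C}(P_{k_j}(K),L_{k_j},A_{k_j,u}),\quad \sup\mathrm{C}_{i+k_j}=\sup\mathrm{C}(P_{i+k_j}(K),\,P_i(L)\parallel\sup\mathrm{C}_{k_j},\,A_{i+k_j,u}).$$ (a) The language $\parallel_{j=1}^m\parallel_{i\in I_j}\sup\mathrm{C}_{i+k_j}$ is a sublanguage of $K$ that is controllable with respect to $L$ and $A_u$, and coobservable with respect to $L$ and the alphabets $(A_i\cup A_{k_j})_{j=1,\dots,m;\;i\in I_j}$. (b) If, for all $j=1,\dots,m$, $\bigcap_{i\in I_j}P^{i+k_j}_{k_j}(\sup\mathrm{C}_{i+k_j})$ is controllable with respect to $L_{k_j}$ and $A_{k_j,u}$, and $P^{k_j}_k:A_{k_j}^*\to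 A_k^*$ is an $L_{k_j}$-observer and OCC for $L_{k_j}$, then $$\parallel_{j=1}^m\parallel_{i\in I_j}\sup\mathrm{C}_{i+k_j}=\sup\mathrm{2cC}(K,L,A_{i+k_j}),$$ i.e. it is the supremal two-level conditionally controllable sublanguage of $K$ (for the modular plant with components of languages $P_i(L)$), that is, the largest controllable and coobservable language obtainable by the two-level coordination.
   Context: All languages are assumed to be prefix-closed ($L=\overline{L}$; the empty language is allowed). A generator is a deterministic finite automaton with a partial transition function, and its generated language $L(G)$ is the set of strings on which the (extended) transition function is defined from the initial state. For alphabets $B\subseteq A$, the projection $P:A^*\to B^*$ is the homomorphism erasing the letters of $A\setminus B$ and fixing those of $B$. For $L_i\subseteq A_i^*$ with $A=\bigcup_iA_i$, the synchronous product is $\|_iL_i=\bigcap_iP_i^{-1}(L_i)\subseteq A^*$, where $P_i:A^*\to A_i^*$ are projections. Setting: $\Sigma$ is the alphabet of $G$; agent $i\in\{1,\dots,n\}$ observes $\Sigma_{o,i}\subseteq\Sigma$ and controls $\Sigma_{c,i}\subseteq\Sigma$; $\Sigma_c=\bigcup_i\Sigma_{c,i}$. Put $A_i=\Sigma_{o,i}$, $A_{c,i}=\Sigma_{o,i}\cap\Sigma_{c,i}$, $A=\bigcup_iA_i$, $A_c=\bigcup_iA_{c,i}$, $A_u=A\setminus A_c$; languages $K\subseteq L$ are over $A$ (every event of $G$ is observed by some agent). It is assumed that $\Sigma_{o,i}\cap\Sigma_{c,j}\subseteq\Sigma_{c,i}$ for all $i,j$ (shared events have the same controllability status). The set $\{1,\dots,n\}$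 is partitioned into groups $I_1,\dots,I_m$; $A_{I_j}=\bigcup_{i\in I_j}A_i$. An alphabet $A_k\subseteq A$ satisfies $A_k\supseteq\bigcup_{r\neq\ell}(A_{I_r}\cap A_{I_\ell})$, and for $j=1,\dots,m$ the alphabet $A_{k_j}$ satisfies $A_k\cup\bigcup_{p,q\in I_j,\,p\ne q}(A_p\cap A_q)\subseteq A_{k_j}\subseteq A_{I_j}\cup A_k$. Projections: $P_i:A^*\to A_i^*$; $P_{k_j}$ projects to $A_{k_j}^*$ (and $P_{k_j}(P_i(L))$ is regarded as a language over $A_i\cap A_{k_j}$); $P_{i+k_j}:A^*\to(A_i\cup A_{k_j})^*$; $P_{I_r+k}:A^*\to(A_{I_r}\cup A_k)^*$; $P^{i+k_j}_{k_j}:(A_i\cup A_{k_j})^*\to A_{k_j}^*$. Also $A_{k_j,u}=A_{k_j}\cap A_u$ and $A_{i+k_j,u}=(A_i\cup A_{k_j})\cap A_u$. $K$ is two-level conditionally decomposable with respect to $(A_i)$, $(A_{k_j})$, $A_k$ if $K=\|_{r=1}^mP_{I_r+k}(K)$ and, for $r=1,\dots,m$, $P_{I_r+k}(K)=\|_{i\in I_r}P_{i+k_r}(K)$ (recall $A_k\subseteq A_{k_r}$). A language $K'$ is controllable with respect to $L'$ and $A'_u$ if $K'A'_u\cap L'\subseteq K'$. $\sup\mathrm{C}(K',L',A'_u)$ is the largest (prefix-closed) language contained in $K'\cap L'$ that is controllable with respect to $L'$ and $A'_u$. Coobservability (C&P): let agents $x$ range over a finite set, with observed alphabets $B_x\subseteq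 A$, projections $P_x:A^*\to B_x^*$ and locally controllable events $B_{c,x}$. A language $K'\subseteq L$ is coobservable with respect to $L$ and $(B_x)_x$ if for all $s\in K'$ and $a\in A_c$ with $sa\in L\setminus K'$ there is an agent $x$ such that $a\in B_{c,x}$ and $\big(P_x^{-1}(P_x(s))\{a\}\big)\cap K'=\emptyset$. For the alphabets $B_x=A_i\cup A_{k_j}$ (agent $i$ of group $I_j$ with communicated coordinator events), the locally controllable events are $(A_i\cup A_{k_j})\cap A_c$. A language $K'\subseteq\|_{i=1}^nP_i(L)$ is two-level conditionally controllable if (1) for all $j=1,\dots,m$, $P_{k_j}(K')$ is controllable with respect to $L_{k_j}$ and $A_{k_j,u}$; and (2) for all $j$ and $i\in I_j$, $P_{i+k_j}(K')$ is controllable with respect to $P_i(L)\parallel P_{k_j}(K')$ and $A_{i+k_j,u}$. $\sup\mathrm{2cC}(K,L,A_{i+k_j})$ denotes the largest two-level conditionally controllable sublanguage of $K$, which always exists. A projection $Q:B^*\to C^*$, $C\subseteq B$, is an $L'$-observer for $L'\subseteq B^*$ if for every $t\in Q(L')$ and $s\in L'$ such that $Q(s)$ is a prefix of $t$ there is $u\in B^*$ with $su\in L'$ and $Q(su)=t$. It is OCC (output control consistent) for $L'$ if for every $s\in L'$ of the form $s=\sigma_1\cdots\sigma_\ell$ or $s=s'\sigma_0\sigma_1\cdots\sigma_\ell$ with $\ell\ge1$, $s'\in B^*$, $\sigma_0,\sigma_\ell\in C$ (only $\sigma_\ell\in C$ in the first form) and $\sigma_1,\dots,\sigma_{\ell-1}\in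 B\setminus C$: if $\sigma_\ell\in A_u$, then $\sigma_1,\dots,\sigma_{\ell-1}\in A_u$. *)

theory Defs
  imports Main "HOL-Library.Sublist" "HOL-Library.Disjoint_Sets"
begin

text \<open>
  Strings are lists of events, languages are sets of strings. An alphabet is an explicit set of
  events, so operations that depend on the alphabet of a language take it as an argument.
\<close>

subsection \<open>Generators\<close>

record ('q, 'a) generator =
  gen_states :: "'q set"
  gen_events :: "'a set"
  gen_step :: "'q \<Rightarrow> 'a \<Rightarrow> 'q option"
  gen_init :: 'q

text \<open>Only the values of the transition function on states and events of the generator matter.\<close>

definition is_generator :: "('q, 'a) generator \<Rightarrow> bool" where
  "is_generator G \<longleftrightarrow>
     finite (gen_states G) \<and> finite (gen_events G) \<and> gen_init G \<in> gen_states G \<and>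
     (\<forall>q\<in>gen_states G. \<forall>a\<in>gen_events G. \<forall>q'. gen_step G q a = Some q' \<longrightarrow> q' \<in> gen_states G)"

primrec gen_run :: "('q, 'a) generator \<Rightarrow> 'q \<Rightarrow> 'a list \<Rightarrow> 'q option" where
  "gen_run G q [] = Some q"
| "gen_run G q (a # w) = Option.bind (gen_step G q a) (\<lambda>q'. gen_run G q' w)"

definition gen_lang :: "('q, 'a) generator \<Rightarrow> 'a list set" where
  "gen_lang G = {w \<in> lists (gen_events G). gen_run G (gen_init G) w \<noteq> None}"

subsection \<open>Languages, projections, synchronous products\<close>

definition prefix_closed :: "'a list set \<Rightarrow> bool" where
  "prefix_closed L \<longleftrightarrow> (\<forall>w\<in>L. \<forall>v. prefix v w \<longrightarrow> v \<in> L)"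

text \<open>
  The projection to \<open>B\<^sup>*\<close>. The source alphabet is not recorded; the projections of the form
  \<open>P\<^sup>C\<^sub>B : C\<^sup>* \<rightarrow> B\<^sup>*\<close> are all restrictions of this function.
\<close>

definition proj :: "'a set \<Rightarrow> 'a list \<Rightarrow> 'a list" where
  "proj B w = filter (\<lambda>a. a \<in> B) w"

definition inv_proj :: "'a set \<Rightarrow> 'a set \<Rightarrow> 'a list set \<Rightarrow> 'a list set" where
  "inv_proj A B S = {w \<in> lists A. proj B w \<in> S}"

text \<open>The language \<open>M i\<close> is regarded as a language over \<open>B i\<close>.\<close>

definition sync_prod :: "'i set \<Rightarrow> ('i \<Rightarrow> 'a set) \<Rightarrow> ('i \<Rightarrow> 'a list set) \<Rightarrow> 'a list set" where
  "sync_prod I B M =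
     (let A = (\<Union>i\<in>I. B i) in lists A \<inter> (\<Inter>i\<in>I. inv_proj A (B i) (M i)))"

definition sync_prod2 :: "'a set \<Rightarrow> 'a list set \<Rightarrow> 'a set \<Rightarrow> 'a list set \<Rightarrow> 'a list set" where
  "sync_prod2 B\<^sub>1 M\<^sub>1 B\<^sub>2 M\<^sub>2 =
     inv_proj (B\<^sub>1 \<union> B\<^sub>2) B\<^sub>1 M\<^sub>1 \<inter> inv_proj (B\<^sub>1 \<union> B\<^sub>2) B\<^sub>2 M\<^sub>2"

subsection \<open>Controllability, coobservability, observers, OCC\<close>

definition controllable :: "'a list set \<Rightarrow> 'a list set \<Rightarrow> 'a set \<Rightarrow> bool" where
  "controllable K L Au \<longleftrightarrow> {s @ [a] | s a. s \<in> K \<and> a \<in> Au} \<inter> L \<subseteq> K"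

definition supC :: "'a list set \<Rightarrow> 'a list set \<Rightarrow> 'a set \<Rightarrow> 'a list set" where
  "supC K L Au = (GREATEST M. prefix_closed M \<and> M \<subseteq> K \<inter> L \<and> controllable M L Au)"

text \<open>
  \<open>X\<close> is the set of agents; agent \<open>x\<close> observes \<open>B x\<close> and controls \<open>Bc x\<close>. \<open>A\<close> is the global
  alphabet and \<open>Ac\<close> the set of its controllable events.
\<close>

definition coobservable ::
  "'a set \<Rightarrow> 'a set \<Rightarrow> 'x set \<Rightarrow> ('x \<Rightarrow> 'a set) \<Rightarrow> ('x \<Rightarrow> 'a set) \<Rightarrow>
   'a list set \<Rightarrow> 'a list set \<Rightarrow> bool" where
  "coobservable A Ac X B Bc K L \<longleftrightarrow>
     K \<subseteq> L \<and>
     (\<forall>s\<in>K. \<forall>a\<in>Ac. s @ [a] \<in> L - K \<longrightarrow>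
        (\<exists>x\<in>X. a \<in> Bc x \<and>
           {t @ [a] | t. t \<in> inv_proj A (B x) {proj (B x) s}} \<inter> K = {}))"

text \<open>\<open>B\<close> and \<open>C \<subseteq> B\<close> are the source and target alphabets of the projection.\<close>

definition observer :: "'a set \<Rightarrow> 'a set \<Rightarrow> 'a list set \<Rightarrow> bool" where
  "observer B C L \<longleftrightarrow>
     (\<forall>t\<in>proj C ` L. \<forall>s\<in>L. prefix (proj C s) t \<longrightarrow>
        (\<exists>u\<in>lists B. s @ u \<in> L \<and> proj C (s @ u) = t))"

text \<open>\<open>ts\<close> is \<open>\<sigma>\<^sub>1 \<dots> \<sigma>\<^sub>\<ell>\<^sub>-\<^sub>1\<close> (possibly empty) and \<open>c\<close> is \<open>\<sigma>\<^sub>\<ell>\<close>.\<close>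

definition OCC :: "'a set \<Rightarrow> 'a set \<Rightarrow> 'a set \<Rightarrow> 'a list set \<Rightarrow> bool" where
  "OCC B C Au L \<longleftrightarrow>
     (\<forall>s\<in>L. \<forall>ts\<in>lists (B - C). \<forall>c\<in>C.
        (s = ts @ [c] \<or> (\<exists>s'\<in>lists B. \<exists>b\<in>C. s = s' @ [b] @ ts @ [c])) \<longrightarrow>
        c \<in> Au \<longrightarrow> set ts \<subseteq> Au)"

subsection \<open>Two-level coordination\<close>

text \<open>
  In the following, agents are \<open>1, \<dots>, n\<close> with alphabets \<open>A i\<close>, the groups are \<open>I 1, \<dots>, I m\<close>,
  \<open>Ak\<close> is \<open>A\<^sub>k\<close> and \<open>Akg j\<close> is the group coordinator alphabet \<open>A\<^sub>k\<^sub>j\<close>.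
\<close>

definition two_level_cond_decomposable ::
  "(nat \<Rightarrow> 'a set) \<Rightarrow> nat \<Rightarrow> (nat \<Rightarrow> nat set) \<Rightarrow> (nat \<Rightarrow> 'a set) \<Rightarrow> 'a set \<Rightarrow> 'a list set \<Rightarrow> bool"
where
  "two_level_cond_decomposable A m I Akg Ak K \<longleftrightarrow>
     K = sync_prod {1..m} (\<lambda>r. (\<Union>i\<in>I r. A i) \<union> Ak) (\<lambda>r. proj ((\<Union>i\<in>I r. A i) \<union> Ak) ` K) \<and>
     (\<forall>r\<in>{1..m}. proj ((\<Union>i\<in>I r. A i) \<union> Ak) ` K =
        sync_prod (I r) (\<lambda>i. A i \<union> Akg r) (\<lambda>i. proj (A i \<union> Akg r) ` K))"

text \<open>The language \<open>L\<^sub>k\<^sub>j\<close>, where \<open>B\<close> is \<open>A\<^sub>k\<^sub>j\<close>.\<close>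

definition coord_plant :: "nat \<Rightarrow> (nat \<Rightarrow> 'a set) \<Rightarrow> 'a list set \<Rightarrow> 'a set \<Rightarrow> 'a list set" where
  "coord_plant n A L B = sync_prod {1..n} (\<lambda>i. A i \<inter> B) (\<lambda>i. proj B ` proj (A i) ` L)"

definition two_level_cond_controllable ::
  "nat \<Rightarrow> (nat \<Rightarrow> 'a set) \<Rightarrow> nat \<Rightarrow> (nat \<Rightarrow> nat set) \<Rightarrow> (nat \<Rightarrow> 'a set) \<Rightarrow> 'a set \<Rightarrow>
   'a list set \<Rightarrow> 'a list set \<Rightarrow> bool"
where
  "two_level_cond_controllable n A m I Akg Au L K' \<longleftrightarrow>
     K' \<subseteq> sync_prod {1..n} A (\<lambda>i. proj (A i) ` L) \<and>
     (\<forall>j\<in>{1..m}. controllable (proj (Akg j) ` K') (coord_plant n A L (Akg j)) (Akg j \<inter> Au)) \<and>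
     (\<forall>j\<in>{1..m}. \<forall>i\<in>I j.
        controllable (proj (A i \<union> Akg j) ` K')
          (sync_prod2 (A i) (proj (A i) ` L) (Akg j) (proj (Akg j) ` K'))
          ((A i \<union> Akg j) \<inter> Au))"

definition sup2cC ::
  "nat \<Rightarrow> (nat \<Rightarrow> 'a set) \<Rightarrow> nat \<Rightarrow> (nat \<Rightarrow> nat set) \<Rightarrow> (nat \<Rightarrow> 'a set) \<Rightarrow> 'a set \<Rightarrow>
   'a list set \<Rightarrow> 'a list set \<Rightarrow> 'a list set"
where
  "sup2cC n A m I Akg Au K L =
     (GREATEST M. prefix_closed M \<and> M \<subseteq> K \<and> two_level_cond_controllable n A m I Akg Au L M)"

subsection \<open>Existence of the supremal languages\<close>

text \<open>The two \<open>GREATEST\<close> operators above are well defined.\<close>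

lemma Greatest_Union:
  assumes "P (\<Union>{M. P M})"
  shows "P (Greatest P)" and "P N \<Longrightarrow> N \<subseteq> Greatest P"
proof -
  have "Greatest P = \<Union>{M. P M}"
    by (rule Greatest_equality) (use assms in auto)
  then show "P (Greatest P)" and "P N \<Longrightarrow> N \<subseteq> Greatest P"
    using assms by auto
qed

lemma prefix_closed_Union: "(\<And>M. M \<in> F \<Longrightarrow> prefix_closed M) \<Longrightarrow> prefix_closed (\<Union>F)"
  unfolding prefix_closed_def by blast

lemma controllable_iff:
  "controllable K L Au \<longleftrightarrow> (\<forall>s\<in>K. \<forall>a\<in>Au. s @ [a] \<in> L \<longrightarrow> s @ [a] \<in> K)"
  unfolding controllable_def by blast

theorem supC_greatest:
  shows "prefix_closed (supC K L Au)" and "supC K L Au \<subseteq> K \<inter> L"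
    and "controllable (supC K L Au) L Au"
    and "prefix_closed M \<Longrightarrow> M \<subseteq> K \<inter> L \<Longrightarrow> controllable M L Au \<Longrightarrow> M \<subseteq> supC K L Au"
proof -
  let ?P = "\<lambda>M. prefix_closed M \<and> M \<subseteq> K \<inter> L \<and> controllable M L Au"
  have "?P (\<Union>{M. ?P M})"
  proof (intro conjI)
    show "prefix_closed (\<Union>{M. ?P M})" by (rule prefix_closed_Union) auto
    show "controllable (\<Union>{M. ?P M}) L Au" unfolding controllable_iff by blast
  qed auto
  note * = Greatest_Union[of ?P, OF this, folded supC_def]
  show "prefix_closed (supC K L Au)" "supC K L Au \<subseteq> K \<inter> L" "controllable (supC K L Au) L Au"
    using *(1) by auto
  show "prefix_closed M \<Longrightarrow> M \<subseteq> K \<inter> L \<Longrightarrow> controllable M L Au \<Longrightarrow> M \<subseteq> supC K L Au"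
    using *(2) by blast
qed

lemma proj_proj: "proj B (proj C w) = proj (B \<inter> C) w"
  unfolding proj_def by (simp add: conj_commute)

lemma proj_coord_plant:
  assumes "K' \<subseteq> sync_prod {1..n} A (\<lambda>i. proj (A i) ` L)"
  shows "proj B ` K' \<subseteq> coord_plant n A L B"
proof
  fix v assume "v \<in> proj B ` K'"
  then obtain w where w: "w \<in> K'" "v = proj B w" by blast
  then have wA: "set w \<subseteq> (\<Union>i\<in>{1..n}. A i)" and wL: "\<And>i. i \<in> {1..n} \<Longrightarrow> proj (A i) w \<in> proj (A i) ` L"
    using assms unfolding sync_prod_def inv_proj_def Let_def by auto
  have "set v \<subseteq> (\<Union>i\<in>{1..n}. A i \<inter> B)"
    using wA unfolding w(2) proj_def by auto
  moreover have "proj (A i \<inter> B) v \<in> proj B ` proj (A i) ` L" if "i \<in> {1..n}" for i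
  proof -
    have "proj (A i \<inter> B) v = proj B (proj (A i) w)"
      unfolding w(2) proj_def by (auto intro: filter_cong)
    then show ?thesis using wL[OF that] by simp
  qed
  ultimately show "v \<in> coord_plant n A L B"
    unfolding coord_plant_def sync_prod_def inv_proj_def Let_def by (auto simp: subset_iff)
qed

theorem sup2cC_greatest:
  shows "prefix_closed (sup2cC n A m I Akg Au K L)" and "sup2cC n A m I Akg Au K L \<subseteq> K"
    and "two_level_cond_controllable n A m I Akg Au L (sup2cC n A m I Akg Au K L)"
    and "prefix_closed M \<Longrightarrow> M \<subseteq> K \<Longrightarrow> two_level_cond_controllable n A m I Akg Au L M \<Longrightarrow>
           M \<subseteq> sup2cC n A m I Akg Au K L"
proof -
  let ?C = "two_level_cond_controllable n A m I Akg Au L"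
  let ?P = "\<lambda>M. prefix_closed M \<and> M \<subseteq> K \<and> ?C M"
  let ?U = "\<Union>{M. ?P M}"
  have 1: "controllable (proj (Akg j) ` M) (coord_plant n A L (Akg j)) (Akg j \<inter> Au)"
    if "?P M" "j \<in> {1..m}" for M j
    using that unfolding two_level_cond_controllable_def by blast
  have sub: "?U \<subseteq> sync_prod {1..n} A (\<lambda>i. proj (A i) ` L)"
    unfolding two_level_cond_controllable_def by blast
  have "?C ?U"
  proof (rule two_level_cond_controllable_def[THEN iffD2], intro conjI ballI)
    show "?U \<subseteq> sync_prod {1..n} A (\<lambda>i. proj (A i) ` L)" by (rule sub)
  next
    fix j assume j: "j \<in> {1..m}"
    show "controllable (proj (Akg j) ` ?U) (coord_plant n A L (Akg j)) (Akg j \<inter> Au)"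
      unfolding controllable_iff
    proof (intro ballI impI)
      fix s a assume s: "s \<in> proj (Akg j) ` ?U" and a: "a \<in> Akg j \<inter> Au"
        and sa: "s @ [a] \<in> coord_plant n A L (Akg j)"
      from s obtain M where M: "?P M" "s \<in> proj (Akg j) ` M" by blast
      then have "s @ [a] \<in> proj (Akg j) ` M"
        using 1[OF M(1) j] a sa unfolding controllable_iff by blast
      with M(1) show "s @ [a] \<in> proj (Akg j) ` ?U" by blast
    qed
  next
    fix j i assume j: "j \<in> {1..m}" and i: "i \<in> I j"
    show "controllable (proj (A i \<union> Akg j) ` ?U)
        (sync_prod2 (A i) (proj (A i) ` L) (Akg j) (proj (Akg j) ` ?U)) ((A i \<union> Akg j) \<inter> Au)"
      unfolding controllable_iff
    proof (intro ballI impI)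
      fix s a assume s: "s \<in> proj (A i \<union> Akg j) ` ?U" and a: "a \<in> (A i \<union> Akg j) \<inter> Au"
        and sa: "s @ [a] \<in> sync_prod2 (A i) (proj (A i) ` L) (Akg j) (proj (Akg j) ` ?U)"
      from s obtain M w where M: "?P M" "w \<in> M" "s = proj (A i \<union> Akg j) w" by blast
      have "Akg j \<inter> (A i \<union> Akg j) = Akg j" by blast
      then have "proj (Akg j) s = proj (Akg j) w" unfolding M(3) proj_proj by simp
      then have ps: "proj (Akg j) s \<in> proj (Akg j) ` M" using M(2) by simp
      have psa: "proj (Akg j) (s @ [a]) \<in> proj (Akg j) ` ?U"
        using sa unfolding sync_prod2_def inv_proj_def by blast
      have "proj (Akg j) (s @ [a]) \<in> proj (Akg j) ` M"
      proof (cases "a \<in> Akg j")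
        case True
        then have eq: "proj (Akg j) (s @ [a]) = proj (Akg j) s @ [a]" by (simp add: proj_def)
        have "proj (Akg j) s @ [a] \<in> coord_plant n A L (Akg j)"
          using psa proj_coord_plant[OF sub] unfolding eq by blast
        then show ?thesis
          using 1[OF M(1) j] ps True a unfolding eq controllable_iff by blast
      next
        case False
        then show ?thesis using ps by (simp add: proj_def)
      qed
      then have sa': "s @ [a] \<in> sync_prod2 (A i) (proj (A i) ` L) (Akg j) (proj (Akg j) ` M)"
        using sa unfolding sync_prod2_def inv_proj_def by blast
      have "controllable (proj (A i \<union> Akg j) ` M)
          (sync_prod2 (A i) (proj (A i) ` L) (Akg j) (proj (Akg j) ` M)) ((A i \<union> Akg j) \<inter> Au)"
        using M(1) i j unfolding two_level_cond_controllable_def by blast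
      then have "s @ [a] \<in> proj (A i \<union> Akg j) ` M"
        using sa' M(2,3) a unfolding controllable_iff by blast
      with M(1) show "s @ [a] \<in> proj (A i \<union> Akg j) ` ?U" by blast
    qed
  qed
  moreover have "prefix_closed ?U" by (rule prefix_closed_Union) auto
  ultimately have "?P ?U" by blast
  note * = Greatest_Union[of ?P, OF this, folded sup2cC_def]
  show "prefix_closed (sup2cC n A m I Akg Au K L)" "sup2cC n A m I Akg Au K L \<subseteq> K"
    "?C (sup2cC n A m I Akg Au K L)"
    using *(1) by auto
  show "prefix_closed M \<Longrightarrow> M \<subseteq> K \<Longrightarrow> ?C M \<Longrightarrow> M \<subseteq> sup2cC n A m I Akg Au K L"
    using *(2) by blast
qed

end

theory Submission
  imports Defs
begin

text \<open>
  The product \<open>M\<close> consists of the words over the global alphabet whose projection to every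
  \<open>A\<^sub>i \<union> A\<^sub>k\<^sub>j\<close> lies in \<open>supC\<^sub>i\<^sub>+\<^sub>k\<^sub>j\<close>, so all of (a), and the fact that \<open>M\<close> contains every two-level
  conditionally controllable sublanguage of \<open>K\<close>, can be checked one component at a time.

  For (b) it remains to see that \<open>M\<close> itself is two-level conditionally controllable. Distinct
  alphabets \<open>A\<^sub>i \<union> A\<^sub>k\<^sub>j\<close> of one group meet in \<open>A\<^sub>k\<^sub>j\<close> and the alphabets of distinct groups meet in
  \<open>A\<^sub>k\<close>, so words of the components that agree on the shared events can be merged. Let \<open>N\<^sub>j\<close> be the
  intersection of the projections of the \<open>supC\<^sub>i\<^sub>+\<^sub>k\<^sub>j\<close> to \<open>A\<^sub>k\<^sub>j\<close>. If \<open>sa \<in> L\<^sub>k\<^sub>j\<close> with \<open>s \<in> P\<^sub>k\<^sub>j(M)\<close>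
  and \<open>a\<close> uncontrollable, then \<open>sa \<in> N\<^sub>j\<close> by assumption. As \<open>N\<^sub>j \<subseteq> P\<^sub>k\<^sub>j(K)\<close>, the word \<open>sa\<close> is the
  projection of a word of the plant, and so \<open>P\<^sub>k(sa) \<in> P\<^sub>k(L\<^sub>k\<^sub>l)\<close> for every other group \<open>l\<close>; the observer
  and OCC properties then give an uncontrollable continuation inside \<open>N\<^sub>l\<close>. Taking \<open>sa\<close> from
  \<open>P\<^sub>k\<^sub>j(K)\<close> is essential, since \<open>P\<^sub>k(L\<^sub>k\<^sub>j)\<close> and \<open>P\<^sub>k(L\<^sub>k\<^sub>l)\<close> may differ.
\<close>

subsection \<open>Projections and prefix-closed languages\<close>

lemma proj_Nil [simp]: "proj B [] = []"
  by (simp add: proj_def)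

lemma proj_append [simp]: "proj B (v @ w) = proj B v @ proj B w"
  by (simp add: proj_def)

lemma proj_Cons: "proj B (a # w) = (if a \<in> B then a # proj B w else proj B w)"
  by (simp add: proj_def)

lemma proj_in_lists: "proj B w \<in> lists B"
  by (auto simp: proj_def)

lemma proj_id: "w \<in> lists B \<Longrightarrow> proj B w = w"
  by (auto simp: proj_def filter_id_conv)

lemma proj_cong: "w \<in> lists C \<Longrightarrow> B \<inter> C = B' \<inter> C \<Longrightarrow> proj B w = proj B' w"
  unfolding proj_def by (rule filter_cong) auto

lemma proj_proj_subset: "B \<subseteq> C \<Longrightarrow> proj B (proj C w) = proj B w"
  by (simp add: proj_proj Int_absorb2)

lemma prefix_proj_ex: "prefix v (proj B w) \<Longrightarrow> \<exists>u. prefix u w \<and> proj B u = v"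
proof (induction w rule: rev_induct)
  case (snoc a w)
  show ?case
  proof (cases "prefix v (proj B w)")
    case True
    then show ?thesis using snoc.IH by (metis prefix_snoc)
  next
    case False
    with snoc.prems have "proj B (w @ [a]) = v"
      by (auto simp: proj_Cons split: if_splits)
    then show ?thesis by blast
  qed
qed simp

lemma prefix_closed_proj:
  assumes "prefix_closed S"
  shows "prefix_closed (proj B ` S)"
  unfolding prefix_closed_def
proof (intro ballI allI impI)
  fix x v assume "x \<in> proj B ` S" and "prefix v x"
  then obtain w u where "w \<in> S" "prefix u w" "proj B u = v" using prefix_proj_ex by blast
  with assms show "v \<in> proj B ` S" unfolding prefix_closed_def by blast
qed

lemma prefix_closedD: "prefix_closed S \<Longrightarrow> v @ w \<in> S \<Longrightarrow> v \<in> S"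
  unfolding prefix_closed_def by auto

lemma gen_run_append:
  "gen_run G q (v @ w) = Option.bind (gen_run G q v) (\<lambda>q'. gen_run G q' w)"
  by (induction v arbitrary: q) (auto split: bind_splits)

lemma prefix_closed_gen_lang: "prefix_closed (gen_lang G)"
  unfolding prefix_closed_def gen_lang_def prefix_def by (auto simp: gen_run_append bind_eq_Some_conv)

lemma in_sync_prod_iff:
  "w \<in> sync_prod X B S \<longleftrightarrow> w \<in> lists (\<Union>x\<in>X. B x) \<and> (\<forall>x\<in>X. proj (B x) w \<in> S x)"
  unfolding sync_prod_def inv_proj_def Let_def by auto

lemma in_sync_prod2_iff:
  "w \<in> sync_prod2 B S C T \<longleftrightarrow> w \<in> lists (B \<union> C) \<and> proj B w \<in> S \<and> proj C w \<in> T"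
  unfolding sync_prod2_def inv_proj_def by auto

lemma prefix_closed_sync_prod:
  assumes "\<And>x. x \<in> X \<Longrightarrow> prefix_closed (S x)"
  shows "prefix_closed (sync_prod X B S)"
  unfolding prefix_closed_def
proof (intro ballI allI impI)
  fix w v assume w: "w \<in> sync_prod X B S" and "prefix v w"
  then obtain u where "w = v @ u" by (auto simp: prefix_def)
  with w show "v \<in> sync_prod X B S"
    unfolding in_sync_prod_iff using prefix_closedD[OF assms] by auto
qed

lemma subset_sync_prod_proj:
  "S \<subseteq> lists (\<Union>x\<in>X. B x) \<Longrightarrow> S \<subseteq> sync_prod X B (\<lambda>x. proj (B x) ` S)"
  unfolding in_sync_prod_iff subset_iff by blast

subsection \<open>Merging words that agree on shared events\<close>

text \<open>The hypothesis says that \<open>x\<close> and \<open>w\<close> agree on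
  \<open>B \<inter> C\<close>. The merge follows \<open>x\<close>: a letter outside \<open>C\<close>
  is emitted at once, a shared letter only after the private letters that precede its match in
  \<open>w\<close>.\<close>

lemma merge_words:
  assumes "x \<in> lists B" "w \<in> lists C" "proj C x = proj B w"
  shows "\<exists>y \<in> lists (B \<union> C). proj B y = x \<and> proj C y = w"
  using assms
proof (induction x arbitrary: w rule: list.induct)
  case Nil
  then show ?case by (intro bexI[of _ w]) (auto simp: proj_id)
next
  case (Cons a x)
  have a: "a \<in> B" and x: "x \<in> lists B" using Cons.prems(1) by auto
  show ?case
  proof (cases "a \<in> C")
    case False
    then obtain y where "y \<in> lists (B \<union> C)" "proj B y = x" "proj C y = w"
      using Cons.IH[OF x Cons.prems(2)] Cons.prems(3) by (auto simp: proj_Cons)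
    with a False show ?thesis by (intro bexI[of _ "a # y"]) (auto simp: proj_Cons)
  next
    case True
    with Cons.prems(3) have "filter (\<lambda>a. a \<in> B) w = a # proj C x"
      by (simp add: proj_def)
    then obtain us vs where w: "w = us @ a # vs" and us: "\<forall>u\<in>set us. u \<notin> B"
      and vs: "proj C x = proj B vs"
      unfolding filter_eq_Cons_iff proj_def by blast
    have lists: "us \<in> lists C" "vs \<in> lists C" using Cons.prems(2) w by auto
    obtain y where y: "y \<in> lists (B \<union> C)" "proj B y = x" "proj C y = vs"
      using Cons.IH[OF x lists(2) vs] by blast
    have "proj B us = []" using us by (simp add: proj_def filter_empty_conv)
    with y a True lists w show ?thesis
      by (intro bexI[of _ "us @ a # y"]) (auto simp: proj_Cons proj_id)
  qed
qed

text \<open>The words \<open>f x\<close> are attached one at a time. Distinct \<open>B x\<close>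
  overlap only inside \<open>D\<close>, so what has been merged meets the next alphabet only within
  \<open>D\<close>, where \<open>v\<close> secures agreement. \<open>D\<close> need not lie in
  \<open>B x\<close>, hence the projection of \<open>v\<close>.\<close>

lemma merge_family:
  assumes "finite X" "\<And>x. x \<in> X \<Longrightarrow> f x \<in> lists (B x)"
    and "\<And>x y. x \<in> X \<Longrightarrow> y \<in> X \<Longrightarrow> x \<noteq> y \<Longrightarrow> B x \<inter> B y \<subseteq> D"
    and v: "v \<in> lists D" and "\<And>x. x \<in> X \<Longrightarrow> proj D (f x) = proj (B x) v"
  shows "\<exists>w \<in> lists (D \<union> (\<Union>x\<in>X. B x)). proj D w = v \<and> (\<forall>x\<in>X. proj (B x) w = f x)"
  using assms(1-3,5)
proof (induction X)
  case empty
  show ?case using v by (auto simp: proj_id)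
next
  case (insert x X)
  let ?E = "D \<union> (\<Union>y\<in>X. B y)"
  obtain w where w: "w \<in> lists ?E" "proj D w = v" "\<forall>y\<in>X. proj (B y) w = f y"
    using insert.IH insert.prems by (metis insertCI)
  have meet: "?E \<inter> B x = D \<inter> B x"
    using insert.prems(2) insert.hyps(2) by blast
  have fx: "f x \<in> lists (B x)" using insert.prems(1) by blast
  have "proj (B x) w = proj (B x \<inter> D) w"
    using w(1) by (rule proj_cong) (use meet in blast)
  also have "\<dots> = proj D (f x)"
    using insert.prems(3)[of x] by (simp add: w(2)[symmetric] proj_proj)
  also have "\<dots> = proj ?E (f x)"
    using fx by (rule proj_cong) (use meet in blast)
  finally obtain y where y: "y \<in> lists (?E \<union> B x)" "proj ?E y = w" "proj (B x) y = f x"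
    using merge_words[OF w(1) fx] by blast
  \<comment> \<open>Merging leaves the projection to \<open>?E\<close> unchanged, so the projections
    fixed earlier survive.\<close>
  have "proj C y = proj C w" if "C \<subseteq> ?E" for C
    using proj_proj_subset[OF that, of y] y(2) by simp
  then have "proj D y = v" "\<forall>z\<in>X. proj (B z) y = f z"
    using w(2,3) by (simp, metis UN_upper le_supI2)
  with y show ?case by (intro bexI[of _ y]) auto
qed

subsection \<open>Controllability, observers and OCC\<close>

lemma controllableD:
  "controllable S L Au \<Longrightarrow> s \<in> S \<Longrightarrow> a \<in> Au \<Longrightarrow> s @ [a] \<in> L \<Longrightarrow> s @ [a] \<in> S"
  unfolding controllable_iff by blast

lemma controllable_append:
  assumes "controllable S L Au" "prefix_closed L" "s \<in> S" "set u \<subseteq> Au" "s @ u \<in> L"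
  shows "s @ u \<in> S"
  using assms(4,5)
proof (induction u rule: rev_induct)
  case Nil
  then show ?case using assms(3) by simp
next
  case (snoc a u)
  then have "s @ u \<in> S" using prefix_closedD[OF assms(2), of "s @ u" "[a]"] by simp
  then show ?case using controllableD[OF assms(1), of "s @ u" a] snoc.prems by simp
qed

text \<open>The observer property continues \<open>s\<close> within \<open>L\<close> so that the
  projection gains \<open>a\<close>; OCC makes the new letters before \<open>a\<close>
  uncontrollable, and controllability then keeps the continuation in \<open>N\<close>.\<close>

lemma observer_OCC_extend:
  assumes ctrl: "controllable N L (B \<inter> Au)" and NL: "N \<subseteq> L"
    and L: "prefix_closed L" "L \<subseteq> lists B"
    and obs: "observer B C L" and occ: "OCC B C Au L" and "C \<subseteq> B"
    and s: "s \<in> N" and a: "a \<in> C" "a \<in> Au" and sa: "proj C s @ [a] \<in> proj C ` L"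
  shows "proj C s @ [a] \<in> proj C ` N"
proof -
  obtain u where u: "s @ u \<in> L" "proj C (s @ u) = proj C s @ [a]"
    using obs[unfolded observer_def, rule_format, OF sa, of s] s NL by (auto simp: prefix_def)
  then have "filter (\<lambda>a. a \<in> C) u = [a]" by (simp add: proj_def)
  then obtain us vs where split: "u = us @ a # vs" and us: "\<forall>x\<in>set us. x \<notin> C"
    unfolding filter_eq_Cons_iff by blast
  \<comment> \<open>The continuation may run on through letters outside \<open>C\<close>, so it is
    cut right after \<open>a\<close>.\<close>
  have sus: "s @ us @ [a] \<in> L"
    using prefix_closedD[OF L(1), of "s @ us @ [a]" vs] u(1) split by simp
  then have in_B: "set s \<subseteq> B" "set us \<subseteq> B" using L(2) by auto
  \<comment> \<open>OCC speaks of a segment following a letter of \<open>C\<close> or starting the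
    word. That segment also includes the tail \<open>q\<close> of \<open>s\<close>, or all of
    \<open>s\<close>.\<close>
  have "set us \<subseteq> Au"
  proof (cases "\<exists>x\<in>set s. x \<in> C")
    case True
    then obtain p b q where "s = p @ b # q" "b \<in> C" "\<forall>x\<in>set q. x \<notin> C"
      using split_list_last_prop[of s "\<lambda>x. x \<in> C"] by blast
    with in_B us have "s @ us @ [a] = p @ [b] @ (q @ us) @ [a]" "p \<in> lists B"
      "q @ us \<in> lists (B - C)"
      by (auto simp: subset_iff)
    then have "set (q @ us) \<subseteq> Au"
      using occ[unfolded OCC_def, rule_format, OF sus, of "q @ us" a] \<open>b \<in> C\<close> a by blast
    then show ?thesis by simp
  next
    case False
    with in_B us have "s @ us \<in> lists (B - C)" by auto
    then have "set (s @ us) \<subseteq> Au"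
      using occ[unfolded OCC_def, rule_format, OF sus, of "s @ us" a] a by simp
    then show ?thesis by simp
  qed
  with in_B a \<open>C \<subseteq> B\<close> have "set (us @ [a]) \<subseteq> B \<inter> Au" by auto
  then have "s @ us @ [a] \<in> N" by (rule controllable_append[OF ctrl L(1) s _ sus])
  moreover have "proj C (s @ us @ [a]) = proj C s @ [a]"
    using us a by (simp add: proj_def)
  ultimately show ?thesis by (metis image_eqI)
qed

subsection \<open>The coordinated product\<close>

locale two_level_coordination =
  fixes n m :: nat
    and A :: "nat \<Rightarrow> 'a set"
    and I :: "nat \<Rightarrow> nat set"
    and E Au Ak :: "'a set"
    and Akg :: "nat \<Rightarrow> 'a set"
    and K L M :: "'a list set"
    and Lk supCk :: "nat \<Rightarrow> 'a list set"
    and supCik :: "nat \<Rightarrow> nat \<Rightarrow> 'a list set"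
  assumes E: "E = (\<Union>i\<in>{1..n}. A i)"
    and groups: "(\<Union>j\<in>{1..m}. I j) = {1..n}" "\<And>j. j \<in> {1..m} \<Longrightarrow> I j \<noteq> {}"
    and Ak: "Ak \<subseteq> E"
      "\<And>r l. r \<in> {1..m} \<Longrightarrow> l \<in> {1..m} \<Longrightarrow> r \<noteq> l \<Longrightarrow>
         (\<Union>i\<in>I r. A i) \<inter> (\<Union>i\<in>I l. A i) \<subseteq> Ak"
    and Akg: "\<And>j. j \<in> {1..m} \<Longrightarrow> Ak \<subseteq> Akg j"
      "\<And>j p q. j \<in> {1..m} \<Longrightarrow> p \<in> I j \<Longrightarrow> q \<in> I j \<Longrightarrow> p \<noteq> q \<Longrightarrow> A p \<inter> A q \<subseteq> Akg j"
      "\<And>j. j \<in> {1..m} \<Longrightarrow> Akg j \<subseteq> (\<Union>i\<in>I j. A i) \<union> Ak"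
    and L: "prefix_closed L" "L \<subseteq> lists E"
    and K: "K \<subseteq> L"
    and decomposable: "two_level_cond_decomposable A m I Akg Ak K"
    and Lk: "\<And>j. Lk j = coord_plant n A L (Akg j)"
    and supCk: "\<And>j. supCk j = supC (proj (Akg j) ` K) (Lk j) (Akg j \<inter> Au)"
    and supCik: "\<And>i j. supCik i j =
      supC (proj (A i \<union> Akg j) ` K)
        (sync_prod2 (A i) (proj (A i) ` L) (Akg j) (supCk j))
        ((A i \<union> Akg j) \<inter> Au)"
    and M: "M = sync_prod {1..m} (\<lambda>j. \<Union>i\<in>I j. A i \<union> Akg j)
      (\<lambda>j. sync_prod (I j) (\<lambda>i. A i \<union> Akg j) (\<lambda>i. supCik i j))"
begin

section \<open>Alphabets of agents and groups\<close>

lemma agentI: "j \<in> {1..m} \<Longrightarrow> i \<in> I j \<Longrightarrow> i \<in> {1..n}"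
  using groups(1) by blast

lemma finite_group: "j \<in> {1..m} \<Longrightarrow> finite (I j)"
  using agentI by (meson finite_atLeastAtMost finite_subset subsetI)

lemma agent_alphabet: "j \<in> {1..m} \<Longrightarrow> i \<in> I j \<Longrightarrow> A i \<subseteq> E"
  using agentI[of j i] unfolding E by blast

lemma Akg_subset: "j \<in> {1..m} \<Longrightarrow> Akg j \<subseteq> E"
  using Akg(3)[of j] Ak(1) agent_alphabet[of j] by (meson UN_least Un_least order_trans)

lemma local_alphabet: "j \<in> {1..m} \<Longrightarrow> i \<in> I j \<Longrightarrow> A i \<union> Akg j \<subseteq> E"
  by (intro Un_least agent_alphabet Akg_subset)

text \<open>This matches the alphabets of the product with those of the decomposition. Nonemptiness
  of the group is what brings \<open>Akg j\<close>, and with it \<open>Ak\<close>, into the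
  left-hand side.\<close>

lemma group_alphabet: "j \<in> {1..m} \<Longrightarrow> (\<Union>i\<in>I j. A i \<union> Akg j) = (\<Union>i\<in>I j. A i) \<union> Ak"
  using Akg(1)[of j] Akg(3)[of j] groups(2)[of j] by blast

lemma total_alphabet: "(\<Union>j\<in>{1..m}. \<Union>i\<in>I j. A i \<union> Akg j) = E"
proof
  show "(\<Union>j\<in>{1..m}. \<Union>i\<in>I j. A i \<union> Akg j) \<subseteq> E"
    by (intro UN_least local_alphabet)
  show "E \<subseteq> (\<Union>j\<in>{1..m}. \<Union>i\<in>I j. A i \<union> Akg j)"
    unfolding E groups(1)[symmetric] by blast
qed

lemma agents_meet:
  assumes "j \<in> {1..m}" "p \<in> I j" "q \<in> I j" "p \<noteq> q"
  shows "(A p \<union> Akg j) \<inter> (A q \<union> Akg j) \<subseteq> Akg j"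
  using Akg(2)[OF assms] by blast

lemma groups_meet:
  assumes "r \<in> {1..m}" "l \<in> {1..m}" "r \<noteq> l"
  shows "(\<Union>i\<in>I r. A i \<union> Akg r) \<inter> (\<Union>i\<in>I l. A i \<union> Akg l) \<subseteq> Ak"
  using Ak(2)[OF assms] unfolding group_alphabet[OF assms(1)] group_alphabet[OF assms(2)] by blast

text \<open>The nested product flattens, because projecting to the group alphabet first does not
  affect the projection to a local alphabet inside it.\<close>

lemma in_M_iff:
  "w \<in> M \<longleftrightarrow> w \<in> lists E \<and> (\<forall>j\<in>{1..m}. \<forall>i\<in>I j. proj (A i \<union> Akg j) w \<in> supCik i j)"
proof -
  have "proj (A i \<union> Akg j) (proj (\<Union>i\<in>I j. A i \<union> Akg j) w) = proj (A i \<union> Akg j) w"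
    if "i \<in> I j" for i j
    by (rule proj_proj_subset) (use that in blast)
  moreover have "proj (\<Union>i\<in>I j. A i \<union> Akg j) w \<in> lists (\<Union>i\<in>I j. A i \<union> Akg j)" for j
    by (rule proj_in_lists)
  ultimately show ?thesis
    unfolding M in_sync_prod_iff total_alphabet by (simp cong: conj_cong ball_cong)
qed

lemma in_MD:
  "w \<in> M \<Longrightarrow> j \<in> {1..m} \<Longrightarrow> i \<in> I j \<Longrightarrow> proj (A i \<union> Akg j) w \<in> supCik i j"
  by (simp add: in_M_iff)

section \<open>Local supremal languages and coordinator plants\<close>

lemma supCik_subset_K: "supCik i j \<subseteq> proj (A i \<union> Akg j) ` K"
  using supC_greatest(2) unfolding supCik by blast

lemma supCik_subset_sync:
  "supCik i j \<subseteq> sync_prod2 (A i) (proj (A i) ` L) (Akg j) (supCk j)"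
  using supC_greatest(2) unfolding supCik by blast

lemma supCik_controllable:
  "controllable (supCik i j) (sync_prod2 (A i) (proj (A i) ` L) (Akg j) (supCk j))
     ((A i \<union> Akg j) \<inter> Au)"
  unfolding supCik by (rule supC_greatest(3))

lemma supCk_controllable: "controllable (supCk j) (Lk j) (Akg j \<inter> Au)"
  unfolding supCk by (rule supC_greatest(3))

lemma supCk_subset_Lk: "supCk j \<subseteq> Lk j"
  using supC_greatest(2) unfolding supCk by blast

lemma proj_in_supCk: "w \<in> supCik i j \<Longrightarrow> proj (Akg j) w \<in> supCk j"
  using supCik_subset_sync[of i j] by (auto simp only: in_sync_prod2_iff)

lemma proj_M_supCk:
  assumes "w \<in> M" "j \<in> {1..m}"
  shows "proj (Akg j) w \<in> supCk j"
proof -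
  obtain i where "i \<in> I j" using groups(2)[OF assms(2)] by blast
  from proj_in_supCk[OF in_MD[OF assms this]] show ?thesis
    by (simp add: proj_proj_subset)
qed

lemma L_subset_modular: "L \<subseteq> sync_prod {1..n} A (\<lambda>i. proj (A i) ` L)"
  using L(2) unfolding E by (rule subset_sync_prod_proj)

lemma proj_L_Lk: "proj (Akg j) ` L \<subseteq> Lk j"
  unfolding Lk by (rule proj_coord_plant[OF L_subset_modular])

lemma prefix_closed_Lk: "prefix_closed (Lk j)"
  unfolding Lk coord_plant_def using L(1)
  by (intro prefix_closed_sync_prod prefix_closed_proj)

lemma Lk_alphabet: "Lk j \<subseteq> lists (Akg j)"
  unfolding Lk coord_plant_def by (auto simp: in_sync_prod_iff)

section \<open>Part (a): sublanguage, controllability, coobservability\<close>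

lemma prefix_closed_M: "prefix_closed M"
  unfolding M supCik by (intro prefix_closed_sync_prod supC_greatest(1))

text \<open>Each \<open>supCik i j\<close> lies in the matching projection of \<open>K\<close>, so
  the decomposition reassembles agents into groups and groups into \<open>K\<close>.\<close>

lemma M_subset_K: "M \<subseteq> K"
proof
  fix w assume w: "w \<in> M"
  have K1: "K = sync_prod {1..m} (\<lambda>r. (\<Union>i\<in>I r. A i) \<union> Ak)
      (\<lambda>r. proj ((\<Union>i\<in>I r. A i) \<union> Ak) ` K)"
    and K2: "\<And>r. r \<in> {1..m} \<Longrightarrow> proj ((\<Union>i\<in>I r. A i) \<union> Ak) ` K =
      sync_prod (I r) (\<lambda>i. A i \<union> Akg r) (\<lambda>i. proj (A i \<union> Akg r) ` K)"
    using decomposable unfolding two_level_cond_decomposable_def by blast+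
  have "proj ((\<Union>i\<in>I r. A i) \<union> Ak) w \<in> proj ((\<Union>i\<in>I r. A i) \<union> Ak) ` K"
    if r: "r \<in> {1..m}" for r
    unfolding K2[OF r] in_sync_prod_iff group_alphabet[OF r]
  proof (intro conjI ballI)
    fix i assume i: "i \<in> I r"
    have "A i \<union> Akg r \<subseteq> (\<Union>i\<in>I r. A i) \<union> Ak"
      using i unfolding group_alphabet[OF r, symmetric] by blast
    then show "proj (A i \<union> Akg r) (proj ((\<Union>i\<in>I r. A i) \<union> Ak) w) \<in> proj (A i \<union> Akg r) ` K"
      using in_MD[OF w r i] supCik_subset_K[of i r] by (simp only: proj_proj_subset) blast
  qed (rule proj_in_lists)
  moreover have "(\<Union>r\<in>{1..m}. (\<Union>i\<in>I r. A i) \<union> Ak) = E"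
    unfolding total_alphabet[symmetric] by (simp only: group_alphabet cong: SUP_cong)
  moreover have "w \<in> lists E" using w unfolding in_M_iff by blast
  ultimately have "w \<in> sync_prod {1..m} (\<lambda>r. (\<Union>i\<in>I r. A i) \<union> Ak)
      (\<lambda>r. proj ((\<Union>i\<in>I r. A i) \<union> Ak) ` K)"
    unfolding in_sync_prod_iff by (simp only:) blast
  then show "w \<in> K" by (simp only: K1[symmetric])
qed

text \<open>Each component is extended in two stages: controllability of \<open>supCk j\<close>
  keeps the coordinator part, which places the local word in the plant for which
  \<open>supCik i j\<close> is controllable.\<close>

lemma M_controllable: "controllable M L Au"
  unfolding controllable_iff
proof (intro ballI impI)
  fix s a assume s: "s \<in> M" and a: "a \<in> Au" and sa: "s @ [a] \<in> L"
  have "proj (A i \<union> Akg j) (s @ [a]) \<in> supCik i j" if j: "j \<in> {1..m}" and i: "i \<in> I j" for i j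
  proof (cases "a \<in> A i \<union> Akg j")
    case False
    then show ?thesis using in_MD[OF s j i] by (simp add: proj_Cons)
  next
    case True
    have "proj (Akg j) (s @ [a]) \<in> supCk j"
    proof (cases "a \<in> Akg j")
      case True
      moreover have "proj (Akg j) (s @ [a]) \<in> Lk j" using proj_L_Lk sa by blast
      ultimately show ?thesis
        using controllableD[OF supCk_controllable proj_M_supCk[OF s j], of a] a
        by (simp add: proj_Cons)
    qed (use proj_M_supCk[OF s j] in \<open>simp add: proj_Cons\<close>)
    then have "proj (A i \<union> Akg j) (s @ [a])
        \<in> sync_prod2 (A i) (proj (A i) ` L) (Akg j) (supCk j)"
      using sa proj_in_lists[of "A i \<union> Akg j" "s @ [a]"]
      unfolding in_sync_prod2_iff by (simp only: proj_proj_subset Un_upper1 Un_upper2) blast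
    then show ?thesis
      using controllableD[OF supCik_controllable in_MD[OF s j i], of a] a True
      by (simp add: proj_Cons)
  qed
  moreover have "s @ [a] \<in> lists E" using sa L(2) by blast
  ultimately show "s @ [a] \<in> M" unfolding in_M_iff by blast
qed

text \<open>If \<open>s @ [a]\<close> leaves \<open>M\<close>, some component rejects its
  projection, and that agent observes \<open>a\<close>. For every \<open>t\<close> that it cannot
  tell from \<open>s\<close>, it rejects \<open>t @ [a]\<close> as well.\<close>

lemma M_coobservable:
  "coobservable E Ac (SIGMA j:{1..m}. I j) (\<lambda>(j, i). A i \<union> Akg j)
     (\<lambda>(j, i). (A i \<union> Akg j) \<inter> Ac) M L"
  unfolding coobservable_def
proof (intro conjI ballI impI)
  show "M \<subseteq> L" using M_subset_K K by blast
next
  fix s a assume s: "s \<in> M" and a: "a \<in> Ac" and sa: "s @ [a] \<in> L - M"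
  then have "s @ [a] \<in> lists E" "s @ [a] \<notin> M" using L(2) by blast+
  then obtain i j where j: "j \<in> {1..m}" and i: "i \<in> I j"
    and out: "proj (A i \<union> Akg j) (s @ [a]) \<notin> supCik i j"
    unfolding in_M_iff by blast
  with in_MD[OF s j i] have aB: "a \<in> A i \<union> Akg j"
    by (auto simp: proj_Cons split: if_splits)
  have "t @ [a] \<notin> M" if "proj (A i \<union> Akg j) t = proj (A i \<union> Akg j) s" for t
    using in_MD[OF _ j i, of "t @ [a]"] out that by auto
  then have "{t @ [a] | t. t \<in> inv_proj E (A i \<union> Akg j) {proj (A i \<union> Akg j) s}} \<inter> M = {}"
    unfolding inv_proj_def by auto
  with i j a aB show "\<exists>x\<in>SIGMA j:{1..m}. I j.
      a \<in> (case x of (j, i) \<Rightarrow> (A i \<union> Akg j) \<inter> Ac) \<and>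
      {t @ [a] | t. t \<in> inv_proj E (case x of (j, i) \<Rightarrow> A i \<union> Akg j)
        {proj (case x of (j, i) \<Rightarrow> A i \<union> Akg j) s}} \<inter> M = {}"
    by (intro bexI[of _ "(j, i)"]) auto
qed

section \<open>Domination of all conditionally controllable sublanguages\<close>

lemma cond_controllable_subset_M:
  assumes pc: "prefix_closed K'" and "K' \<subseteq> K"
    and K': "two_level_cond_controllable n A m I Akg Au L K'"
  shows "K' \<subseteq> M"
proof
  fix w assume w: "w \<in> K'"
  \<comment> \<open>Coordinators come first: this inclusion is needed before the local projections
    of \<open>K'\<close> can compete for \<open>supCik i j\<close>.\<close>
  have sub: "proj (Akg j) ` K' \<subseteq> supCk j" if j: "j \<in> {1..m}" for j
    unfolding supCk
  proof (rule supC_greatest(4))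
    show "proj (Akg j) ` K' \<subseteq> proj (Akg j) ` K \<inter> Lk j"
      using \<open>K' \<subseteq> K\<close> K proj_L_Lk[of j] by blast
    show "controllable (proj (Akg j) ` K') (Lk j) (Akg j \<inter> Au)"
      using K' j unfolding two_level_cond_controllable_def Lk by blast
  qed (rule prefix_closed_proj[OF pc])
  have "proj (A i \<union> Akg j) ` K' \<subseteq> supCik i j" if j: "j \<in> {1..m}" and i: "i \<in> I j" for i j
    unfolding supCik
  proof (rule supC_greatest(4))
    show "proj (A i \<union> Akg j) ` K' \<subseteq>
        proj (A i \<union> Akg j) ` K \<inter> sync_prod2 (A i) (proj (A i) ` L) (Akg j) (supCk j)"
    proof
      fix v assume "v \<in> proj (A i \<union> Akg j) ` K'"
      then obtain x where "x \<in> K'" "v = proj (A i \<union> Akg j) x" by blast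
      then show "v \<in> proj (A i \<union> Akg j) ` K
          \<inter> sync_prod2 (A i) (proj (A i) ` L) (Akg j) (supCk j)"
        using \<open>K' \<subseteq> K\<close> K sub[OF j] proj_in_lists[of "A i \<union> Akg j" x]
        unfolding Int_iff in_sync_prod2_iff
        by (simp only: proj_proj_subset Un_upper1 Un_upper2) blast
    qed
    show "controllable (proj (A i \<union> Akg j) ` K')
        (sync_prod2 (A i) (proj (A i) ` L) (Akg j) (supCk j)) ((A i \<union> Akg j) \<inter> Au)"
      unfolding controllable_iff
    proof (intro ballI impI)
      fix s a assume s: "s \<in> proj (A i \<union> Akg j) ` K'" and a: "a \<in> (A i \<union> Akg j) \<inter> Au"
        and sa: "s @ [a] \<in> sync_prod2 (A i) (proj (A i) ` L) (Akg j) (supCk j)"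
      from s have s': "proj (Akg j) s \<in> proj (Akg j) ` K'"
        by (auto simp: proj_proj_subset)
      \<comment> \<open>Local controllability of \<open>K'\<close> refers to the smaller plant built
        from its own coordinator projection. Since \<open>supCk j \<subseteq> Lk j\<close>,
        coordinator controllability brings \<open>s @ [a]\<close> into that plant.\<close>
      have "proj (Akg j) (s @ [a]) \<in> proj (Akg j) ` K'"
      proof (cases "a \<in> Akg j")
        case True
        have "controllable (proj (Akg j) ` K') (Lk j) (Akg j \<inter> Au)"
          using K' j unfolding two_level_cond_controllable_def Lk by blast
        moreover have "proj (Akg j) (s @ [a]) \<in> Lk j"
          using sa supCk_subset_Lk unfolding in_sync_prod2_iff by blast
        ultimately show ?thesis
          using controllableD[OF _ s', of "Lk j" "Akg j \<inter> Au" a] True a by (simp add: proj_Cons)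
      qed (use s' in \<open>simp add: proj_Cons\<close>)
      then have "s @ [a] \<in> sync_prod2 (A i) (proj (A i) ` L) (Akg j) (proj (Akg j) ` K')"
        using sa unfolding in_sync_prod2_iff by blast
      moreover have ctrl: "controllable (proj (A i \<union> Akg j) ` K')
          (sync_prod2 (A i) (proj (A i) ` L) (Akg j) (proj (Akg j) ` K')) ((A i \<union> Akg j) \<inter> Au)"
        using K' j i unfolding two_level_cond_controllable_def by blast
      ultimately show "s @ [a] \<in> proj (A i \<union> Akg j) ` K'"
        by (intro controllableD[OF ctrl s a])
    qed
  qed (rule prefix_closed_proj[OF pc])
  moreover have "w \<in> lists E" using w \<open>K' \<subseteq> K\<close> K L(2) by blast
  ultimately show "w \<in> M" using w unfolding in_M_iff by blast
qed

section \<open>Lifting local and coordinator words to \<open>M\<close>\<close>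

lemma proj_M_agentI:
  assumes j: "j \<in> {1..m}" and i: "i \<in> I j" and x: "x \<in> supCik i j"
    and w: "w \<in> M" "proj (Akg j) x = proj (Akg j) w"
  shows "x \<in> proj (A i \<union> Akg j) ` M"
proof -
  \<comment> \<open>One component of \<open>w\<close> is replaced by \<open>x\<close>: the alphabet
    \<open>?C\<close> of all other components meets \<open>?B\<close> exactly in
    \<open>Akg j\<close>, where \<open>x\<close> and \<open>w\<close> agree.\<close>
  let ?B = "A i \<union> Akg j"
  let ?X = "{(l, p). l \<in> {1..m} \<and> p \<in> I l \<and> (l, p) \<noteq> (j, i)}"
  let ?C = "Akg j \<union> (\<Union>(l, p)\<in>?X. A p \<union> Akg l)"
  \<comment> \<open>Agents of one group meet in \<open>Akg j\<close>; those of different groups meet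
    in \<open>Ak\<close>, which lies in \<open>Akg j\<close>.\<close>
  have meet1: "(A p \<union> Akg l) \<inter> ?B \<subseteq> Akg j" if "(l, p) \<in> ?X" for l p
  proof (cases "l = j")
    case True
    then show ?thesis using agents_meet[OF j, of p i] i that by auto
  next
    case False
    then show ?thesis using groups_meet[of l j] Akg(1)[OF j] i j that by blast
  qed
  have meet: "?C \<inter> ?B = Akg j"
  proof
    show "?C \<inter> ?B \<subseteq> Akg j" using meet1 by fast
  qed blast
  have xB: "x \<in> lists ?B"
    using supCik_subset_sync x unfolding in_sync_prod2_iff subset_iff by blast
  have "proj ?C x = proj (Akg j) x"
    using xB by (rule proj_cong) (use meet in blast)
  also have "\<dots> = proj ?B (proj ?C w)"
    unfolding w(2) proj_proj using meet by (simp only: Int_commute)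
  finally obtain y where y: "y \<in> lists (?B \<union> ?C)" "proj ?B y = x" "proj ?C y = proj ?C w"
    using merge_words[OF xB proj_in_lists] by blast
  have "proj (A p \<union> Akg l) y \<in> supCik p l" if l: "l \<in> {1..m}" and p: "p \<in> I l" for l p
  proof (cases "(l, p) = (j, i)")
    case True
    then show ?thesis using y(2) x by simp
  next
    case False
    then have sub: "A p \<union> Akg l \<subseteq> ?C" using l p by fast
    have "proj (A p \<union> Akg l) y = proj (A p \<union> Akg l) w"
      using proj_proj_subset[OF sub, of y] proj_proj_subset[OF sub, of w] y(3) by simp
    then show ?thesis using in_MD[OF w(1) l p] by simp
  qed
  moreover have "?B \<union> ?C \<subseteq> E"
    using local_alphabet[OF j i] local_alphabet by (auto simp: subset_iff)
  then have "y \<in> lists E" using y(1) lists_mono by blast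
  ultimately have "y \<in> M" unfolding in_M_iff by blast
  with y(2) show ?thesis by blast
qed

text \<open>One preimage of \<open>v\<close> is chosen per agent. All of them project to
  \<open>v\<close> on \<open>Akg j\<close>, so \<open>merge_family\<close> with
  \<open>D = Akg j\<close> joins them.\<close>

lemma merge_group:
  assumes j: "j \<in> {1..m}" and v: "v \<in> (\<Inter>i\<in>I j. proj (Akg j) ` supCik i j)"
  obtains y where "y \<in> lists (\<Union>i\<in>I j. A i \<union> Akg j)" "proj (Akg j) y = v"
    "\<And>i. i \<in> I j \<Longrightarrow> proj (A i \<union> Akg j) y \<in> supCik i j"
proof -
  have "\<forall>i\<in>I j. \<exists>x. x \<in> supCik i j \<and> proj (Akg j) x = v" using v by blast
  then obtain f where f: "\<And>i. i \<in> I j \<Longrightarrow> f i \<in> supCik i j"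
    "\<And>i. i \<in> I j \<Longrightarrow> proj (Akg j) (f i) = v"
    by metis
  obtain i0 where i0: "i0 \<in> I j" using groups(2)[OF j] by blast
  have vl: "v \<in> lists (Akg j)" using f(2)[OF i0] proj_in_lists by metis
  have fl: "f i \<in> lists (A i \<union> Akg j)" if "i \<in> I j" for i
    using f(1)[OF that] supCik_subset_sync unfolding in_sync_prod2_iff subset_iff by blast
  have fv: "proj (Akg j) (f i) = proj (A i \<union> Akg j) v" if "i \<in> I j" for i
    using f(2)[OF that] proj_id[OF subsetD[OF lists_mono[OF Un_upper2] vl]] by simp
  obtain y where y: "y \<in> lists (Akg j \<union> (\<Union>i\<in>I j. A i \<union> Akg j))"
    "proj (Akg j) y = v" "\<forall>i\<in>I j. proj (A i \<union> Akg j) y = f i"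
    using merge_family[of "I j" f "\<lambda>i. A i \<union> Akg j" "Akg j" v,
      OF finite_group[OF j] fl agents_meet[OF j] vl fv] by blast
  have "Akg j \<union> (\<Union>i\<in>I j. A i \<union> Akg j) = (\<Union>i\<in>I j. A i \<union> Akg j)" using i0 by blast
  then show thesis using that[of y] y f(1) by simp
qed

text \<open>Merging happens twice: \<open>merge_group\<close> builds one word per group, and
  \<open>merge_family\<close> with \<open>D = Ak\<close> joins these along
  \<open>proj Ak v\<close>.\<close>

lemma proj_M_groupI:
  assumes j: "j \<in> {1..m}" and v: "v \<in> (\<Inter>i\<in>I j. proj (Akg j) ` supCik i j)"
    and others: "\<And>l. l \<in> {1..m} \<Longrightarrow> l \<noteq> j \<Longrightarrow>
      proj Ak v \<in> proj Ak ` (\<Inter>i\<in>I l. proj (Akg l) ` supCik i l)"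
  shows "v \<in> proj (Akg j) ` M"
proof -
  let ?B = "\<lambda>l. \<Union>i\<in>I l. A i \<union> Akg l"
  have "\<exists>y. y \<in> lists (?B l) \<and> proj Ak y = proj Ak v \<and> (l = j \<longrightarrow> proj (Akg j) y = v) \<and>
      (\<forall>i\<in>I l. proj (A i \<union> Akg l) y \<in> supCik i l)" if l: "l \<in> {1..m}" for l
  proof -
    \<comment> \<open>Group \<open>j\<close> keeps \<open>v\<close> itself; the others contribute a
      coordinator word with the same projection to \<open>Ak\<close>.\<close>
    obtain u where u: "u \<in> (\<Inter>i\<in>I l. proj (Akg l) ` supCik i l)" "proj Ak u = proj Ak v"
      "l = j \<Longrightarrow> u = v"
      using v others[OF l] by (cases "l = j") auto
    obtain y where y: "y \<in> lists (?B l)" "proj (Akg l) y = u"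
      "\<And>i. i \<in> I l \<Longrightarrow> proj (A i \<union> Akg l) y \<in> supCik i l"
      using merge_group[OF l u(1)] by blast
    have "proj Ak y = proj Ak v"
      using proj_proj_subset[OF Akg(1)[OF l], of y] u(2) y(2) by simp
    then show ?thesis using y u(3) by blast
  qed
  then obtain f where f: "\<And>l. l \<in> {1..m} \<Longrightarrow> f l \<in> lists (?B l)"
    "\<And>l. l \<in> {1..m} \<Longrightarrow> proj Ak (f l) = proj Ak v" "proj (Akg j) (f j) = v"
    "\<And>l i. l \<in> {1..m} \<Longrightarrow> i \<in> I l \<Longrightarrow> proj (A i \<union> Akg l) (f l) \<in> supCik i l"
    using j by metis
  have sub: "Ak \<subseteq> ?B l" if "l \<in> {1..m}" for l
    unfolding group_alphabet[OF that] by blast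
  have agree: "proj Ak (f l) = proj (?B l) (proj Ak v)" if "l \<in> {1..m}" for l
    using f(2)[OF that] sub[OF that] by (simp add: proj_proj Int_absorb1)
  obtain w where w: "w \<in> lists (Ak \<union> (\<Union>l\<in>{1..m}. ?B l))"
    "\<forall>l\<in>{1..m}. proj (?B l) w = f l"
    using merge_family[of "{1..m}" f ?B Ak "proj Ak v",
      OF finite_atLeastAtMost f(1) groups_meet proj_in_lists agree] by blast
  have "proj (A i \<union> Akg l) w \<in> supCik i l" if l: "l \<in> {1..m}" and i: "i \<in> I l" for l i
  proof -
    have "A i \<union> Akg l \<subseteq> ?B l" using i by blast
    from proj_proj_subset[OF this, of w] show ?thesis
      using bspec[OF w(2) l] f(4)[OF l i] by (simp only:)
  qed
  moreover have "w \<in> lists E"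
    using w(1) Ak(1) unfolding total_alphabet by (simp only: Un_absorb1)
  ultimately have "w \<in> M" unfolding in_M_iff by blast
  moreover have "proj (Akg j) w = v"
  proof -
    have "Akg j \<subseteq> ?B j" using groups(2)[OF j] by blast
    from proj_proj_subset[OF this, of w] show ?thesis
      using bspec[OF w(2) j] f(3) by (simp only:)
  qed
  ultimately show ?thesis by blast
qed

section \<open>Part (b): conditional controllability of \<open>M\<close>\<close>

lemma M_cond_controllable:
  assumes ctrl: "\<And>j. j \<in> {1..m} \<Longrightarrow>
      controllable (\<Inter>i\<in>I j. proj (Akg j) ` supCik i j) (Lk j) (Akg j \<inter> Au)"
    and obs: "\<And>j. j \<in> {1..m} \<Longrightarrow> observer (Akg j) Ak (Lk j)"
    and occ: "\<And>j. j \<in> {1..m} \<Longrightarrow> OCC (Akg j) Ak Au (Lk j)"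
  shows "two_level_cond_controllable n A m I Akg Au L M"
  unfolding two_level_cond_controllable_def
proof (intro conjI ballI)
  show "M \<subseteq> sync_prod {1..n} A (\<lambda>i. proj (A i) ` L)"
    using M_subset_K K L_subset_modular by blast
next
  fix j assume j: "j \<in> {1..m}"
  let ?N = "\<lambda>l. \<Inter>i\<in>I l. proj (Akg l) ` supCik i l"
  have M_N: "proj (Akg l) w \<in> ?N l" if "w \<in> M" "l \<in> {1..m}" for w l
  proof
    fix i assume "i \<in> I l"
    then show "proj (Akg l) w \<in> proj (Akg l) ` supCik i l"
      using in_MD[OF that] proj_proj_subset[of "Akg l" "A i \<union> Akg l" w] by (metis Un_upper2 image_eqI)
  qed
  have N_K: "?N l \<subseteq> proj (Akg l) ` K" if l: "l \<in> {1..m}" for l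
  proof
    fix v assume v: "v \<in> ?N l"
    obtain i where "i \<in> I l" using groups(2)[OF l] by blast
    with v obtain x where "x \<in> supCik i l" "v = proj (Akg l) x" by blast
    then show "v \<in> proj (Akg l) ` K"
      using supCik_subset_K[of i l] by (auto simp: proj_proj_subset subset_iff)
  qed
  show "controllable (proj (Akg j) ` M) (coord_plant n A L (Akg j)) (Akg j \<inter> Au)"
    unfolding controllable_iff Lk[symmetric]
  proof (intro ballI impI)
    fix s a assume "s \<in> proj (Akg j) ` M" and a: "a \<in> Akg j \<inter> Au" and sa: "s @ [a] \<in> Lk j"
    then obtain w where w: "w \<in> M" "s = proj (Akg j) w" by blast
    have saN: "s @ [a] \<in> ?N j"
      using controllableD[OF ctrl[OF j] M_N[OF w(1) j], of a] a sa w(2) by blast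
    then obtain x where x: "x \<in> K" "s @ [a] = proj (Akg j) x" using N_K[OF j] by blast
    have P_k: "proj Ak (proj (Akg l) z) = proj Ak z" if "l \<in> {1..m}" for l z
      using Akg(1)[OF that] by (rule proj_proj_subset)
    have "proj Ak (s @ [a]) \<in> proj Ak ` ?N l" if l: "l \<in> {1..m}" for l
    proof (cases "a \<in> Ak")
      \<comment> \<open>An event outside \<open>Ak\<close> leaves the word shared between groups
        unchanged, so \<open>w\<close> still serves every group.\<close>
      case False
      then have "proj Ak (s @ [a]) = proj Ak (proj (Akg l) w)"
        using w(2) by (simp add: proj_Cons P_k[OF j] P_k[OF l])
      then show ?thesis using M_N[OF w(1) l] by blast
    next
      case True
      then have eq: "proj Ak (s @ [a]) = proj Ak (proj (Akg l) w) @ [a]"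
        using w(2) by (simp add: proj_Cons P_k[OF j] P_k[OF l])
      have "proj (Akg l) x \<in> Lk l" using x(1) K proj_L_Lk[of l] by blast
      moreover have "proj Ak (s @ [a]) = proj Ak (proj (Akg l) x)"
        unfolding x(2) by (simp only: P_k[OF j] P_k[OF l])
      ultimately have "proj Ak (s @ [a]) \<in> proj Ak ` Lk l" by blast
      then show ?thesis
        unfolding eq using True a N_K[OF l] K proj_L_Lk[of l]
        by (intro observer_OCC_extend[OF ctrl[OF l] _ prefix_closed_Lk Lk_alphabet obs[OF l]
              occ[OF l] Akg(1)[OF l] M_N[OF w(1) l]]) blast+
    qed
    then show "s @ [a] \<in> proj (Akg j) ` M" by (intro proj_M_groupI[OF j saN])
  qed
next
  fix j i assume j: "j \<in> {1..m}" and i: "i \<in> I j"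
  show "controllable (proj (A i \<union> Akg j) ` M)
      (sync_prod2 (A i) (proj (A i) ` L) (Akg j) (proj (Akg j) ` M)) ((A i \<union> Akg j) \<inter> Au)"
    unfolding controllable_iff
  proof (intro ballI impI)
    fix s a assume s: "s \<in> proj (A i \<union> Akg j) ` M" and a: "a \<in> (A i \<union> Akg j) \<inter> Au"
      and sa: "s @ [a] \<in> sync_prod2 (A i) (proj (A i) ` L) (Akg j) (proj (Akg j) ` M)"
    then obtain w where w: "w \<in> M" "proj (Akg j) (s @ [a]) = proj (Akg j) w"
      unfolding in_sync_prod2_iff by blast
    \<comment> \<open>Coordinator projections of \<open>M\<close> lie in \<open>supCk j\<close>, so
      controllability of \<open>supCik i j\<close> applies. The extended word returns to
      \<open>M\<close> by merging with \<open>w\<close>, which shares its coordinator part.\<close>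
    have "s @ [a] \<in> sync_prod2 (A i) (proj (A i) ` L) (Akg j) (supCk j)"
      using sa proj_M_supCk[OF w(1) j] w(2) unfolding in_sync_prod2_iff by simp
    moreover have "s \<in> supCik i j" using s in_MD[OF _ j i] by blast
    ultimately have "s @ [a] \<in> supCik i j"
      using controllableD[OF supCik_controllable] a by blast
    then show "s @ [a] \<in> proj (A i \<union> Akg j) ` M" using proj_M_agentI[OF j i _ w] by blast
  qed
qed

end

theorem theorem20:
  fixes G :: "('q, 'a) generator"
    and n m :: nat
    and \<Sigma>o \<Sigma>c A :: "nat \<Rightarrow> 'a set"
    and I :: "nat \<Rightarrow> nat set"
    and A_all Ac Au Ak :: "'a set"
    and Akg :: "nat \<Rightarrow> 'a set"
    and K L M :: "'a list set"
    and Lk supCk :: "nat \<Rightarrow> 'a list set"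
    and supCik :: "nat \<Rightarrow> nat \<Rightarrow> 'a list set"
  assumes G: "is_generator G"
    and L: "L = gen_lang G"
    and events: "\<And>i. i \<in> {1..n} \<Longrightarrow> \<Sigma>o i \<subseteq> gen_events G"
      "\<And>i. i \<in> {1..n} \<Longrightarrow> \<Sigma>c i \<subseteq> gen_events G"
    and shared_status: "\<And>i j. i \<in> {1..n} \<Longrightarrow> j \<in> {1..n} \<Longrightarrow> \<Sigma>o i \<inter> \<Sigma>c j \<subseteq> \<Sigma>c i"
    and A: "A = \<Sigma>o"
    and A_all: "A_all = (\<Union>i\<in>{1..n}. A i)"
    and all_observed: "gen_events G \<subseteq> A_all"
    and Ac: "Ac = (\<Union>i\<in>{1..n}. \<Sigma>o i \<inter> \<Sigma>c i)"
    and Au: "Au = A_all - Ac"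
    and groups: "(\<Union>j\<in>{1..m}. I j) = {1..n}" "disjoint_family_on I {1..m}"
      "\<And>j. j \<in> {1..m} \<Longrightarrow> I j \<noteq> {}"
    and Ak: "Ak \<subseteq> A_all"
      "\<And>r l. r \<in> {1..m} \<Longrightarrow> l \<in> {1..m} \<Longrightarrow> r \<noteq> l \<Longrightarrow>
         (\<Union>i\<in>I r. A i) \<inter> (\<Union>i\<in>I l. A i) \<subseteq> Ak"
    and Akg: "\<And>j. j \<in> {1..m} \<Longrightarrow> Ak \<subseteq> Akg j"
      "\<And>j p q. j \<in> {1..m} \<Longrightarrow> p \<in> I j \<Longrightarrow> q \<in> I j \<Longrightarrow> p \<noteq> q \<Longrightarrow> A p \<inter> A q \<subseteq> Akg j"
      "\<And>j. j \<in> {1..m} \<Longrightarrow> Akg j \<subseteq> (\<Union>i\<in>I j. A i) \<union> Ak"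
    and K: "prefix_closed K" "K \<subseteq> L"
    and decomposable: "two_level_cond_decomposable A m I Akg Ak K"
    and Lk: "\<And>j. Lk j = coord_plant n A L (Akg j)"
    and supCk: "\<And>j. supCk j = supC (proj (Akg j) ` K) (Lk j) (Akg j \<inter> Au)"
    and supCik: "\<And>i j. supCik i j =
      supC (proj (A i \<union> Akg j) ` K)
        (sync_prod2 (A i) (proj (A i) ` L) (Akg j) (supCk j))
        ((A i \<union> Akg j) \<inter> Au)"
    and M: "M = sync_prod {1..m} (\<lambda>j. \<Union>i\<in>I j. A i \<union> Akg j)
      (\<lambda>j. sync_prod (I j) (\<lambda>i. A i \<union> Akg j) (\<lambda>i. supCik i j))"
  shows "(prefix_closed M \<and> M \<subseteq> K \<and>
      controllable M L Au \<and>
      coobservable A_all Ac (SIGMA j:{1..m}. I j) (\<lambda>(j, i). A i \<union> Akg j)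
        (\<lambda>(j, i). (A i \<union> Akg j) \<inter> Ac) M L)
    \<and>
    ((\<forall>j\<in>{1..m}.
        controllable (\<Inter>i\<in>I j. proj (Akg j) ` supCik i j) (Lk j) (Akg j \<inter> Au) \<and>
        observer (Akg j) Ak (Lk j) \<and>
        OCC (Akg j) Ak Au (Lk j))
     \<longrightarrow>
      M = sup2cC n A m I Akg Au K L \<and>
      two_level_cond_controllable n A m I Akg Au L M \<and>
      (\<forall>K'. prefix_closed K' \<and> K' \<subseteq> K \<and> two_level_cond_controllable n A m I Akg Au L K'
        \<longrightarrow> K' \<subseteq> M))"
proof -
  have L_alphabet: "L \<subseteq> lists A_all"
    using all_observed unfolding L gen_lang_def by auto
  have L_closed: "prefix_closed L"
    unfolding L by (rule prefix_closed_gen_lang)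
  interpret two_level_coordination n m A I A_all Au Ak Akg K L M Lk supCk supCik
    by unfold_locales
      (fact A_all groups(1,3) Ak Akg L_closed L_alphabet K(2) decomposable Lk supCk supCik M)+
  \<comment> \<open>Conditional controllability makes \<open>M\<close> a competitor for the
    supremum; conversely the supremum is itself conditionally controllable, hence dominated by
    \<open>M\<close>.\<close>
  have "M = sup2cC n A m I Akg Au K L"
    if "two_level_cond_controllable n A m I Akg Au L M"
    using sup2cC_greatest(4)[OF prefix_closed_M M_subset_K that]
      cond_controllable_subset_M[OF sup2cC_greatest(1-3)] by (rule equalityI)
  then show ?thesis
    using prefix_closed_M M_subset_K M_controllable M_coobservable
      M_cond_controllable cond_controllable_subset_M by blast
qed

end
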